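(* Let $X_1,\dots,X_n$ be mutually independent random variables with product distribution $\mu$ and let $A_1,\dots,A_m$ be events, $A_i$ determined by the variables indexed by $\mathrm{vbl}(A_i)\subseteq[n]$, such that $\Pr_\mu(A_i\wedge A_j)=0$ whenever $i\ne j$ and $\mathrm{vbl}(A_i)\cap\mathrm{vbl}(A_j)\ne\emptyset$. Let $\mathcal I$ be the collection of independent sets of the dependency graph on $[m]$ (distinct $i,j$ adjacent iff $\mathrm{vbl}(A_i)\cap\mathrm{vbl}(A_j)\neq\emptyset$), $p_i=\Pr_\mu(A_i)$, and for $I\in\mathcal I$ $$q_I=\sum_{J\in\mathcal I,\ I\subseteq J}(-1)^{|J|-|I|}\prod_{j\in J}p_j,\qquad q_i:=q_{\{i\}}.$$ Run the algorithm: draw all variables independently; in each round, let $I$ be the set of indices of events occurring under the current assignment; if $I=\emptyset$ stop, otherwise independently resample all variables in $\bigcup_{i\in I}\mathrm{vbl}(A_i)$. Let $T$ be the total number of resampled events, i.e. the sum over all rounds of $|I|$. If $q_\emptyset>0$, then $\mathbb E\,T=\sum_{i=1}^m \frac{q_i}{q_\emptyset}$. *)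

theory Defs
  imports "HOL-Probability.Probability"
begin

definition dep_indep_sets :: "(nat \<Rightarrow> nat set) \<Rightarrow> nat \<Rightarrow> nat set set" where
  "dep_indep_sets vbl m =
     {J. J \<subseteq> {..<m} \<and> (\<forall>i\<in>J. \<forall>j\<in>J. i \<noteq> j \<longrightarrow> vbl i \<inter> vbl j = {})}"

definition q_poly :: "(nat \<Rightarrow> nat set) \<Rightarrow> nat \<Rightarrow> (nat \<Rightarrow> real) \<Rightarrow> nat set \<Rightarrow> real" where
  "q_poly vbl m p I =
     (\<Sum>J\<in>{J \<in> dep_indep_sets vbl m. I \<subseteq> J}. (-1::real) ^ (card J - card I) * (\<Prod>j\<in>J. p j))"

definition occurring :: "nat \<Rightarrow> (nat \<Rightarrow> 'b set) \<Rightarrow> 'b \<Rightarrow> nat set" where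
  "occurring m A \<sigma> = {i \<in> {..<m}. \<sigma> \<in> A i}"

text \<open>State of the parallel resampling algorithm after t rounds, driven by a sequence
  omega of independent fresh full samples: omega 0 is the initial assignment, and in round
  t+1 every variable in the union of vbl(A_i) over occurring i is replaced by its value
  in omega (t+1). Once no event occurs, the state no longer changes (the algorithm stopped).\<close>
primrec pr_state ::
  "(nat \<Rightarrow> nat set) \<Rightarrow> nat \<Rightarrow> (nat \<Rightarrow> (nat \<Rightarrow> 'a) set) \<Rightarrow> (nat \<Rightarrow> nat \<Rightarrow> 'a) \<Rightarrow> nat \<Rightarrow> nat \<Rightarrow> 'a"
where
  "pr_state vbl m A \<omega> 0 = \<omega> 0"
| "pr_state vbl m A \<omega> (Suc t) =
     (let \<sigma> = pr_state vbl m A \<omega> t;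
          R = (\<Union>i\<in>occurring m A \<sigma>. vbl i)
      in (\<lambda>k. if k \<in> R then \<omega> (Suc t) k else \<sigma> k))"

text \<open>Total number of resampled events T = sum over all rounds of |I_t|
  (rounds after termination contribute 0).\<close>
definition resample_count ::
  "(nat \<Rightarrow> nat set) \<Rightarrow> nat \<Rightarrow> (nat \<Rightarrow> (nat \<Rightarrow> 'a) set) \<Rightarrow> (nat \<Rightarrow> nat \<Rightarrow> 'a) \<Rightarrow> ennreal" where
  "resample_count vbl m A \<omega> = (\<Sum>t. of_nat (card (occurring m A (pr_state vbl m A \<omega> t))))"

end

theory Submission
  imports Defs
begin

text \<open>For a set \<open>U\<close> of indices let \<open>q U\<close> be the probability that no event outside \<open>U\<close> occurs, and
  let \<open>\<Gamma>\<^sup>+ S\<close> be the closed neighbourhood of \<open>S\<close>.  By extremality \<open>q U\<close> equals the sum of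
  \<open>(-1)\<^sup>|\<^sup>J\<^sup>| p\<^sub>J\<close> over the independent sets \<open>J\<close> avoiding \<open>U\<close>.  Start a round from \<open>\<mu>\<close> restricted to
  the assignments for which no event outside \<open>U\<close> occurs.  On the part where exactly the events in
  \<open>S \<subseteq> U\<close> occur, resampling produces \<open>p\<^sub>S\<close> times \<open>\<mu>\<close> restricted to the assignments for which no event outside
  \<open>\<Gamma>\<^sup>+ S\<close> occurs.  So the expected number \<open>e U\<close> of resampled events satisfies
  \<open>e U = (\<Sum>S \<subseteq> U. p\<^sub>S (|S| q (\<Gamma>\<^sup>+ S) + e (\<Gamma>\<^sup>+ S)))\<close>.  With \<open>r U\<close> the same alternating sum as \<open>q U\<close> but
  weighted by \<open>|J|\<close>, a solution is \<open>r U - q U r {} / q {}\<close>; it is what Euler's operator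
  \<open>\<Sum>i. p\<^sub>i \<partial>/\<partial>p\<^sub>i\<close> makes of the Cartier--Foata identity.  The iteration converges to it because every
  round ends the algorithm with conditional probability at least \<open>q {}\<close>.\<close>

section \<open>Resampling a block of coordinates of a product measure\<close>

lemma measurable_override_on:
  assumes "V \<subseteq> I"
  shows "(\<lambda>(x, y). override_on x y V) \<in> PiM I M \<Otimes>\<^sub>M PiM I M \<rightarrow>\<^sub>M PiM I M"
proof (rule measurable_PiM_single')
  fix i assume "i \<in> I"
  then show "(\<lambda>\<omega>. (case \<omega> of (x, y) \<Rightarrow> override_on x y V) i) \<in> PiM I M \<Otimes>\<^sub>M PiM I M \<rightarrow>\<^sub>M M i"
    by (cases "i \<in> V") (simp_all add: override_on_def split_beta')
qed (use assms in \<open>auto simp: space_pair_measure space_PiM override_on_def PiE_iff extensional_def\<close>)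

text \<open>The old coordinates in \<open>V\<close> are discarded, so \<open>f\<close>, which sees
  nothing else, is independent of the new assignment and factors out. The new assignment again has
  the product law, and \<open>g\<close> takes the same value on it as on the old one, because it
  sees only the coordinates that survive.\<close>

lemma (in product_prob_space) nn_integral_resample:
  assumes fin: "finite I" and V: "V \<subseteq> I"
    and [measurable]: "f \<in> borel_measurable (PiM I M)" "g \<in> borel_measurable (PiM I M)"
      "h \<in> borel_measurable (PiM I M)"
    and f_dep: "\<And>x y. x \<in> space (PiM I M) \<Longrightarrow> y \<in> space (PiM I M) \<Longrightarrow> (\<forall>k\<in>V. x k = y k) \<Longrightarrow> f x = f y"
    and g_dep: "\<And>x y. x \<in> space (PiM I M) \<Longrightarrow> y \<in> space (PiM I M) \<Longrightarrow> (\<forall>k\<in>I - V. x k = y k) \<Longrightarrow> g x = g y"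
  shows "(\<integral>\<^sup>+x. f x * g x * (\<integral>\<^sup>+y. h (override_on x y V) \<partial>PiM I M) \<partial>PiM I M)
    = (\<integral>\<^sup>+x. f x \<partial>PiM I M) * (\<integral>\<^sup>+x. g x * h x \<partial>PiM I M)"
proof -
  define J where "J = I - V"
  have I: "V \<union> J = I" "V \<inter> J = {}" "finite V" "finite J"
    using V fin finite_subset[OF V] by (auto simp: J_def)
  interpret PV: prob_space "PiM V M" by (intro prob_space_PiM prob_space)
  interpret PJ: prob_space "PiM J M" by (intro prob_space_PiM prob_space)
  interpret VJ: pair_prob_space "PiM V M" "PiM J M" ..
  \<comment> \<open>Arbitrary base points, used only to write \<open>f\<close> and \<open>g\<close>
    as functions of a single block.\<close>
  obtain a0 where a0: "a0 \<in> space (PiM V M)" using PV.not_empty by blast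
  obtain b0 where b0: "b0 \<in> space (PiM J M)" using PJ.not_empty by blast
  have mrg [measurable]: "merge V J \<in> measurable (PiM V M \<Otimes>\<^sub>M PiM J M) (PiM I M)"
    using measurable_merge[of V J M] by (simp add: I)
  have mrg_space: "merge V J (a, b) \<in> space (PiM I M)"
    if "a \<in> space (PiM V M)" "b \<in> space (PiM J M)" for a b
    using measurable_space[OF mrg] that by (simp add: space_pair_measure)
  have fold: "(\<integral>\<^sup>+x. F x \<partial>PiM I M) = (\<integral>\<^sup>+a. \<integral>\<^sup>+b. F (merge V J (a, b)) \<partial>PiM J M \<partial>PiM V M)"
    if "F \<in> borel_measurable (PiM I M)" for F
    using product_nn_integral_fold[of V J F] that by (simp add: I)
  define f' where "f' a = f (merge V J (a, b0))" for a
  define g' where "g' b = g (merge V J (a0, b))" for b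
  define h' where "h' a b = h (merge V J (a, b))" for a b
  have [measurable]: "f' \<in> borel_measurable (PiM V M)" "g' \<in> borel_measurable (PiM J M)"
      "(\<lambda>(a, b). h' a b) \<in> borel_measurable (PiM V M \<Otimes>\<^sub>M PiM J M)"
    using a0 b0 by (auto simp: f'_def[abs_def] g'_def[abs_def] h'_def)
  have f': "f (merge V J (a, b)) = f' a" and g': "g (merge V J (a, b)) = g' b"
    if "a \<in> space (PiM V M)" "b \<in> space (PiM J M)" for a b
    unfolding f'_def g'_def using that a0 b0 I
    by (intro f_dep g_dep mrg_space; simp add: merge_def J_def)+
  note measurable_override_on[OF V, measurable]
  have h': "(\<integral>\<^sup>+y. h (override_on (merge V J (a, b)) y V) \<partial>PiM I M) = (\<integral>\<^sup>+c. h' c b \<partial>PiM V M)"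
    if ab [measurable]: "a \<in> space (PiM V M)" "b \<in> space (PiM J M)" for a b
  proof -
    have *: "merge V J (a, b) \<in> space (PiM I M)" by (rule mrg_space) fact+
    have "(\<integral>\<^sup>+y. h (override_on (merge V J (a, b)) y V) \<partial>PiM I M)
       = (\<integral>\<^sup>+c. \<integral>\<^sup>+d. h (override_on (merge V J (a, b)) (merge V J (c, d)) V) \<partial>PiM J M \<partial>PiM V M)"
      using * by (intro fold) measurable
    \<comment> \<open>The result keeps neither the old block \<open>a\<close> nor the fresh block
      \<open>d\<close>, so the integral over \<open>d\<close> is that of a constant.\<close>
    moreover have "override_on (merge V J (a, b)) (merge V J (c, d)) V = merge V J (c, b)" for c d
      using I by (auto simp: override_on_def merge_def fun_eq_iff)
    ultimately show ?thesis by (simp add: h'_def PJ.emeasure_space_1)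
  qed
  have "(\<integral>\<^sup>+x. f x * g x * (\<integral>\<^sup>+y. h (override_on x y V) \<partial>PiM I M) \<partial>PiM I M)
     = (\<integral>\<^sup>+a. \<integral>\<^sup>+b. f (merge V J (a, b)) * g (merge V J (a, b))
          * (\<integral>\<^sup>+y. h (override_on (merge V J (a, b)) y V) \<partial>PiM I M) \<partial>PiM J M \<partial>PiM V M)"
    by (rule fold) measurable
  also have "\<dots> = (\<integral>\<^sup>+a. \<integral>\<^sup>+b. f' a * (g' b * (\<integral>\<^sup>+c. h' c b \<partial>PiM V M)) \<partial>PiM J M \<partial>PiM V M)"
    by (intro nn_integral_cong) (simp add: f' g' h' mult.assoc)
  also have "\<dots> = (\<integral>\<^sup>+a. f' a \<partial>PiM V M) * (\<integral>\<^sup>+b. g' b * (\<integral>\<^sup>+c. h' c b \<partial>PiM V M) \<partial>PiM J M)"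
    by (simp add: nn_integral_cmult nn_integral_multc)
  also have "(\<integral>\<^sup>+b. g' b * (\<integral>\<^sup>+c. h' c b \<partial>PiM V M) \<partial>PiM J M)
      = (\<integral>\<^sup>+b. (\<integral>\<^sup>+c. g' b * h' c b \<partial>PiM V M) \<partial>PiM J M)"
    by (intro nn_integral_cong) (simp add: nn_integral_cmult)
  \<comment> \<open>After the exchange the fresh block \<open>c\<close> stands where the old
    \<open>V\<close>-block stood, and the product integral can be reassembled.\<close>
  also have "\<dots> = (\<integral>\<^sup>+c. (\<integral>\<^sup>+b. g' b * h' c b \<partial>PiM J M) \<partial>PiM V M)"
    by (rule VJ.Fubini') measurable
  also have "\<dots> = (\<integral>\<^sup>+x. g x * h x \<partial>PiM I M)"
    by (subst fold) (auto intro!: nn_integral_cong simp: g' h'_def)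
  also have "(\<integral>\<^sup>+a. f' a \<partial>PiM V M) = (\<integral>\<^sup>+x. f x \<partial>PiM I M)"
    by (simp add: fold f' PJ.emeasure_space_1 cong: nn_integral_cong_simp)
  finally show ?thesis .
qed

section \<open>Alternating sums over independent sets\<close>

lemma sum_alternating_Pow:
  assumes "finite X"
  shows "(\<Sum>S\<in>Pow X. (-1::real) ^ card S) = (if X = {} then 1 else 0)"
proof -
  have "(\<Sum>S\<in>Pow X. (-1::real) ^ card S) = (\<Prod>x\<in>X. 1 - 1)"
    by (subst prod_diff_conv_sum[OF assms]) simp
  also have "\<dots> = (if X = {} then 1 else 0)"
    using assms by (auto simp: card_gt_0_iff)
  finally show ?thesis .
qed

text \<open>The disjunct \<open>i = j\<close> matters when \<open>vbl j\<close> is empty: such a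
  \<open>j\<close> would otherwise be missing from its own neighbourhood.\<close>

definition closed_nbhd :: "(nat \<Rightarrow> nat set) \<Rightarrow> nat \<Rightarrow> nat set \<Rightarrow> nat set" where
  "closed_nbhd vbl m S = {i \<in> {..<m}. \<exists>j\<in>S. i = j \<or> vbl i \<inter> vbl j \<noteq> {}}"

text \<open>The weight \<open>\<psi>\<close> covers both sums of the overview: the constant 1 gives
  \<open>q U\<close>, and \<open>real\<close> gives \<open>r U\<close>. As a function on
  cardinalities it can be shifted by \<open>card S\<close> in the recursion.\<close>

definition alt_sum ::
  "(nat \<Rightarrow> nat set) \<Rightarrow> nat \<Rightarrow> (nat \<Rightarrow> real) \<Rightarrow> (nat \<Rightarrow> real) \<Rightarrow> nat set \<Rightarrow> real" where
  "alt_sum vbl m p \<psi> U =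
     (\<Sum>J\<in>{J \<in> dep_indep_sets vbl m. J \<inter> U = {}}. (-1) ^ card J * prod p J * \<psi> (card J))"

lemma dep_indep_setsD: "J \<in> dep_indep_sets vbl m \<Longrightarrow> J \<subseteq> {..<m}"
  by (simp add: dep_indep_sets_def)

lemma finite_dep_indep_sets [simp]: "finite (dep_indep_sets vbl m)"
  by (rule finite_subset[of _ "Pow {..<m}"]) (auto simp: dep_indep_sets_def)

lemma finite_dep_indep_set: "J \<in> dep_indep_sets vbl m \<Longrightarrow> finite J"
  by (meson dep_indep_setsD finite_lessThan finite_subset)

lemma empty_dep_indep [simp]: "{} \<in> dep_indep_sets vbl m"
  by (simp add: dep_indep_sets_def)

lemma dep_indep_sets_disjoint:
  "J \<in> dep_indep_sets vbl m \<Longrightarrow> i \<in> J \<Longrightarrow> j \<in> J \<Longrightarrow> i \<noteq> j \<Longrightarrow> vbl i \<inter> vbl j = {}"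
  by (simp add: dep_indep_sets_def)

lemma dep_indep_setsI:
  "J \<subseteq> {..<m} \<Longrightarrow> (\<And>i j. i \<in> J \<Longrightarrow> j \<in> J \<Longrightarrow> i \<noteq> j \<Longrightarrow> vbl i \<inter> vbl j = {}) \<Longrightarrow>
    J \<in> dep_indep_sets vbl m"
  by (simp add: dep_indep_sets_def)

lemma dep_indep_sets_mono:
  assumes "J \<in> dep_indep_sets vbl m" "S \<subseteq> J"
  shows "S \<in> dep_indep_sets vbl m"
  using assms dep_indep_setsD[OF assms(1)] dep_indep_sets_disjoint[OF assms(1)]
  by (intro dep_indep_setsI) (meson subsetD subset_trans)+

lemma closed_nbhd_iff:
  "i \<in> closed_nbhd vbl m S \<longleftrightarrow> i < m \<and> (\<exists>j\<in>S. i = j \<or> vbl i \<inter> vbl j \<noteq> {})"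
  by (simp add: closed_nbhd_def)

text \<open>Allows a pair \<open>(S, J)\<close> to be traded for the independent set
  \<open>S \<union> J\<close> with the subset \<open>S\<close> marked, which is the bijection behind
  \<open>alt_sum_recursion\<close>.\<close>

lemma dep_indep_sets_Un_iff:
  "S \<union> J \<in> dep_indep_sets vbl m \<and> S \<inter> J = {} \<longleftrightarrow>
   S \<in> dep_indep_sets vbl m \<and> J \<in> dep_indep_sets vbl m \<and> J \<inter> closed_nbhd vbl m S = {}"
  (is "?L \<longleftrightarrow> ?R")
proof
  assume L: ?L
  have "i \<notin> closed_nbhd vbl m S" if "i \<in> J" for i
  proof
    assume "i \<in> closed_nbhd vbl m S"
    then obtain j where j: "j \<in> S" "i = j \<or> vbl i \<inter> vbl j \<noteq> {}"
      by (auto simp: closed_nbhd_iff)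
    with L that dep_indep_sets_disjoint[of "S \<union> J" vbl m i j] show False by auto
  qed
  with L show ?R
    by (auto intro: dep_indep_sets_mono)
next
  assume R: ?R
  then have sub: "S \<subseteq> {..<m}" "J \<subseteq> {..<m}"
    by (auto dest: dep_indep_setsD)
  have cross: "vbl i \<inter> vbl j = {} \<and> i \<noteq> j" if "i \<in> J" "j \<in> S" for i j
  proof -
    have "i \<notin> closed_nbhd vbl m S" "i < m" using R sub that by auto
    then show ?thesis using that by (auto simp: closed_nbhd_iff)
  qed
  have "S \<union> J \<in> dep_indep_sets vbl m"
  proof (rule dep_indep_setsI)
    fix i j assume ij: "i \<in> S \<union> J" "j \<in> S \<union> J" "i \<noteq> j"
    show "vbl i \<inter> vbl j = {}"
      using ij R cross[of i j] cross[of j i] dep_indep_sets_disjoint[of S vbl m i j]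
        dep_indep_sets_disjoint[of J vbl m i j]
      by (cases "i \<in> S"; cases "j \<in> S") (auto simp: Int_commute)
  qed (use sub in auto)
  moreover have "S \<inter> J = {}" using cross by auto
  ultimately show ?L ..
qed

text \<open>Regroup the pairs \<open>(S, J)\<close> by \<open>R = S \<union> J\<close>. The shift of
  \<open>\<psi>\<close> makes the weight depend on \<open>R\<close> alone, and \<open>S\<close>
  enters only through its sign and runs over all subsets of \<open>R \<inter> U\<close>. These signs
  cancel unless \<open>R\<close> avoids \<open>U\<close>. This is the Cartier--Foata identity in
  weighted form.\<close>

lemma alt_sum_recursion:
  "(\<Sum>S\<in>{S \<in> dep_indep_sets vbl m. S \<subseteq> U}.
      prod p S * alt_sum vbl m p (\<lambda>k. \<psi> (card S + k)) (closed_nbhd vbl m S)) = alt_sum vbl m p \<psi> U"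
proof -
  let ?\<I> = "dep_indep_sets vbl m"
  let ?a = "\<lambda>R. (-1) ^ card R * prod p R * \<psi> (card R)"
  have "(\<Sum>S\<in>{S \<in> ?\<I>. S \<subseteq> U}.
      prod p S * alt_sum vbl m p (\<lambda>k. \<psi> (card S + k)) (closed_nbhd vbl m S))
    = (\<Sum>(S, J)\<in>(SIGMA S:{S \<in> ?\<I>. S \<subseteq> U}. {J \<in> ?\<I>. J \<inter> closed_nbhd vbl m S = {}}).
        prod p S * ((-1) ^ card J * prod p J * \<psi> (card S + card J)))"
    unfolding alt_sum_def sum_distrib_left by (intro sum.Sigma) auto
  also have "\<dots> = (\<Sum>(R, S)\<in>(SIGMA R:?\<I>. Pow (R \<inter> U)). ?a R * (-1) ^ card S)"
  proof (rule sum.reindex_bij_witness[of _ "\<lambda>(R, S). (S, R - S)" "\<lambda>(S, J). (S \<union> J, S)"], goal_cases)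
    case (1 a)
    obtain S J where a: "a = (S, J)" by force
    with 1 have "S \<union> J \<in> ?\<I> \<and> S \<inter> J = {}"
      by (subst dep_indep_sets_Un_iff) simp
    then show ?case by (auto simp: a)
  next
    case (2 a)
    obtain S J where a: "a = (S, J)" by force
    with 2 have "S \<union> J \<in> ?\<I> \<and> S \<inter> J = {}"
      by (subst dep_indep_sets_Un_iff) simp
    with 2 show ?case by (auto simp: a)
  next
    case (3 b)
    then show ?case by (cases b) auto
  next
    case (4 b)
    obtain R S where b: "b = (R, S)" by force
    with 4 have "S \<union> (R - S) = R" "S \<subseteq> U" "R \<in> ?\<I>" by auto
    then show ?case
      using dep_indep_sets_Un_iff[of S "R - S" vbl m] by (simp add: b)
  next
    case (5 a)
    obtain S J where a: "a = (S, J)" by force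
    with 5 have *: "S \<inter> J = {}" "finite S" "finite J"
      using dep_indep_sets_Un_iff[of S J vbl m] by (auto intro: finite_dep_indep_set)
    \<comment> \<open>Only \<open>J\<close> carries a sign on the left of the recursion; the sign of
      \<open>S\<close> is inserted twice, at no cost.\<close>
    have "?a (S \<union> J) * (-1) ^ card S
        = ((-1) ^ card S * (-1) ^ card S) * (prod p S * ((-1) ^ card J * prod p J * \<psi> (card S + card J)))"
      using * by (simp add: card_Un_disjoint prod.union_disjoint power_add)
    also have "(-1 :: real) ^ card S * (-1) ^ card S = 1"
      by (simp flip: power_mult_distrib)
    finally show ?case by (simp add: a)
  qed
  also have "\<dots> = (\<Sum>R\<in>?\<I>. \<Sum>S\<in>Pow (R \<inter> U). ?a R * (-1) ^ card S)"
    by (intro sum.Sigma[symmetric]) (auto intro: finite_dep_indep_set)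
  also have "\<dots> = (\<Sum>R\<in>?\<I>. if R \<inter> U = {} then ?a R else 0)"
    by (intro sum.cong refl, subst sum_distrib_left[symmetric], subst sum_alternating_Pow)
      (auto intro: finite_dep_indep_set)
  also have "\<dots> = alt_sum vbl m p \<psi> U"
    unfolding alt_sum_def by (intro sum.mono_neutral_cong_right) auto
  finally show ?thesis .
qed

section \<open>The linear operator of one round and the series of its iterates\<close>

definition round_op :: "(nat \<Rightarrow> nat set) \<Rightarrow> nat \<Rightarrow> (nat \<Rightarrow> real) \<Rightarrow> (nat set \<Rightarrow> real) \<Rightarrow> nat set \<Rightarrow> real" where
  "round_op vbl m p g U =
     (\<Sum>S\<in>{S \<in> dep_indep_sets vbl m. S \<subseteq> U}. prod p S * g (closed_nbhd vbl m S))"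

lemma closed_nbhd_empty [simp]: "closed_nbhd vbl m {} = {}"
  by (simp add: closed_nbhd_def)

lemma round_op_empty [simp]: "round_op vbl m p g {} = g {}"
proof -
  have "{S \<in> dep_indep_sets vbl m. S \<subseteq> {}} = {{}}" by auto
  then show ?thesis by (simp add: round_op_def)
qed

lemma round_op_iterate_nonneg:
  assumes "\<And>i. i < m \<Longrightarrow> 0 \<le> p i" "\<And>U. 0 \<le> g U"
  shows "0 \<le> (round_op vbl m p ^^ k) g U"
proof (induction k arbitrary: U)
  case (Suc k)
  then show ?case
    using assms(1) by (auto simp: round_op_def[of _ _ _ "(round_op vbl m p ^^ k) g"]
      intro!: sum_nonneg mult_nonneg_nonneg prod_nonneg dest!: dep_indep_setsD)
qed (simp add: assms)

lemma round_op_diff: "round_op vbl m p (\<lambda>U. f U - g U) = (\<lambda>U. round_op vbl m p f U - round_op vbl m p g U)"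
  by (simp add: round_op_def fun_eq_iff right_diff_distrib sum_subtractf)

lemma alt_sum_add: "alt_sum vbl m p (\<lambda>k. f k + g k) U = alt_sum vbl m p f U + alt_sum vbl m p g U"
  by (simp add: alt_sum_def distrib_left sum.distrib)

lemma alt_sum_const: "alt_sum vbl m p (\<lambda>_. c) U = c * alt_sum vbl m p (\<lambda>_. 1) U"
  by (simp add: alt_sum_def sum_distrib_left mult_ac)

text \<open>Once \<open>alt_sum\<close> is read as a probability, this is conservation of mass over
  one round. It makes \<open>q\<close> a fixed weight against which the iterates can be
  measured.\<close>

lemma round_op_alt_sum_one: "round_op vbl m p (alt_sum vbl m p (\<lambda>_. 1)) = alt_sum vbl m p (\<lambda>_. 1)"
  using alt_sum_recursion[where \<psi> = "\<lambda>_. 1"] by (simp add: round_op_def fun_eq_iff)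

text \<open>The summands are the expected numbers of occurring events after \<open>k\<close> rounds.
  With \<open>e\<close> the claimed value and \<open>b\<close> the term for \<open>k = 0\<close>,
  \<open>b = e - ?L e\<close>, so the series telescopes to \<open>e\<close> once the iterates of
  \<open>?L\<close> on \<open>e\<close> tend to 0.\<close>

lemma sums_round_op_iterates:
  fixes vbl :: "nat \<Rightarrow> nat set" and m :: nat and p :: "nat \<Rightarrow> real"
  defines "q \<equiv> alt_sum vbl m p (\<lambda>_. 1)" and "r \<equiv> alt_sum vbl m p real"
  assumes p: "\<And>i. i < m \<Longrightarrow> 0 \<le> p i"
    and q0: "0 < q {}" and q_ge: "\<And>U. q {} \<le> q U" and q_le: "\<And>U. q U \<le> 1"
  shows "(\<lambda>k. (round_op vbl m p ^^ k) (\<lambda>U. \<Sum>S\<in>{S \<in> dep_indep_sets vbl m. S \<subseteq> U}.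
            real (card S) * prod p S * q (closed_nbhd vbl m S)) U) sums (r U - q U * r {} / q {})"
proof -
  let ?L = "round_op vbl m p"
  define b where "b U = (\<Sum>S\<in>{S \<in> dep_indep_sets vbl m. S \<subseteq> U}.
            real (card S) * prod p S * q (closed_nbhd vbl m S))" for U
  \<comment> \<open>Subtracting a multiple of the fixed point \<open>q\<close> leaves
    \<open>e - ?L e\<close> unchanged; the multiple is chosen so that \<open>e {} = 0\<close>, as
    befits a run that has stopped.\<close>
  define e where "e U = r U - q U * (r {} / q {})" for U
  have prod_p: "0 \<le> prod p S" if "S \<in> dep_indep_sets vbl m" for S
    using that dep_indep_setsD[OF that] by (intro prod_nonneg p) auto
  have r_rec: "r U = b U + ?L r U" for U
  proof -
    have "alt_sum vbl m p (\<lambda>k. real (card S + k)) V = real (card S) * q V + r V"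
      for S :: "nat set" and V
      unfolding q_def r_def
      by (subst alt_sum_const[symmetric], subst alt_sum_add[symmetric]) simp
    then have "r U = (\<Sum>S\<in>{S \<in> dep_indep_sets vbl m. S \<subseteq> U}.
        prod p S * (real (card S) * q (closed_nbhd vbl m S) + r (closed_nbhd vbl m S)))"
      using alt_sum_recursion[where \<psi> = real and U = U and vbl = vbl and m = m and p = p] by (simp add: r_def)
    then show ?thesis
      by (simp add: b_def round_op_def distrib_left sum.distrib mult_ac)
  qed
  have L_q: "?L q = q" unfolding q_def by (rule round_op_alt_sum_one)
  have L_e: "?L e U = ?L r U - q U * (r {} / q {})" for U
  proof -
    have "?L e U = ?L r U - ?L q U * (r {} / q {})"
      by (simp add: e_def round_op_def right_diff_distrib sum_subtractf sum_distrib_right mult.assoc sum_divide_distrib)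
    then show ?thesis by (simp add: L_q)
  qed
  have b_eq: "b = (\<lambda>U. e U - ?L e U)"
  proof
    fix U
    show "b U = e U - ?L e U"
      unfolding L_e e_def using r_rec[of U] by linarith
  qed
  have iter: "(?L ^^ k) b = (\<lambda>U. (?L ^^ k) e U - (?L ^^ Suc k) e U)" for k
  proof (induction k)
    case (Suc k)
    then show ?case by (simp add: round_op_diff)
  qed (simp add: b_eq)
  have e0: "(?L ^^ k) e {} = 0" for k
    using q0 by (induction k) (simp_all add: e_def)
  \<comment> \<open>There are finitely many independent sets, so \<open>r\<close> is bounded, and
    \<open>q\<close> is bounded below by \<open>q {} > 0\<close>; hence \<open>e\<close> is
    dominated by a multiple of \<open>q\<close>.\<close>
  obtain C where C: "\<And>U. \<bar>e U\<bar> \<le> C * q U" "0 \<le> C"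
  proof -
    define B where "B = (\<Sum>J\<in>dep_indep_sets vbl m. \<bar>prod p J * real (card J)\<bar>)"
    have "\<bar>r U\<bar> \<le> B" for U
    proof -
      have "\<bar>r U\<bar> \<le> (\<Sum>J\<in>{J \<in> dep_indep_sets vbl m. J \<inter> U = {}}. \<bar>(-1) ^ card J * prod p J * real (card J)\<bar>)"
        unfolding r_def alt_sum_def by (rule sum_abs)
      also have "\<dots> = (\<Sum>J\<in>{J \<in> dep_indep_sets vbl m. J \<inter> U = {}}. \<bar>prod p J * real (card J)\<bar>)"
        by (simp add: abs_mult power_abs)
      also have "\<dots> \<le> B" unfolding B_def by (intro sum_mono2) auto
      finally show ?thesis .
    qed
    moreover have "B \<le> B / q {} * q U" for U
    proof -
      have "0 \<le> B" by (simp add: B_def sum_nonneg)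
      then show ?thesis using q0 q_ge[of U] by (simp add: field_simps mult_left_mono)
    qed
    moreover have "\<bar>e U\<bar> \<le> \<bar>r U\<bar> + \<bar>r {} / q {}\<bar> * q U" for U
    proof -
      have "\<bar>q U\<bar> = q U" using q0 q_ge[of U] by simp
      then show ?thesis
        using abs_triangle_ineq4[of "r U" "q U * (r {} / q {})"]
        by (simp add: e_def abs_mult mult.commute)
    qed
    ultimately have "\<bar>e U\<bar> \<le> (B / q {} + \<bar>r {} / q {}\<bar>) * q U" for U
      by (smt (verit) distrib_right)
    moreover have "0 \<le> B / q {} + \<bar>r {} / q {}\<bar>"
      using q0 by (simp add: B_def sum_nonneg)
    ultimately show ?thesis using that by blast
  qed
  \<comment> \<open>The iterates vanish at \<open>{}\<close>, so the term \<open>S = {}\<close>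
    drops out. In the comparison with \<open>?L q = q\<close> this leaves \<open>q U - q {}\<close>,
    which is at most \<open>(1 - q {}) * q U\<close> because \<open>q U \<le> 1\<close>.\<close>
  have bound: "\<bar>(?L ^^ k) e U\<bar> \<le> C * (1 - q {}) ^ k * q U" for k U
  proof (induction k arbitrary: U)
    case (Suc k)
    let ?I = "{S \<in> dep_indep_sets vbl m. S \<subseteq> U}" and ?N = "closed_nbhd vbl m"
    define D where "D = C * (1 - q {}) ^ k"
    have D: "0 \<le> D" using C q_le[of "{}"] by (simp add: D_def)
    have "\<bar>(?L ^^ Suc k) e U\<bar> = \<bar>\<Sum>S\<in>?I - {{}}. prod p S * (?L ^^ k) e (?N S)\<bar>"
      by (subst sum_diff1) (simp_all add: round_op_def[of _ _ _ "(?L ^^ k) e"] e0)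
    also have "\<dots> \<le> (\<Sum>S\<in>?I - {{}}. prod p S * (D * q (?N S)))"
      using Suc.IH prod_p unfolding D_def
      by (intro order_trans[OF sum_abs] sum_mono) (auto simp: abs_mult intro!: mult_mono)
    also have "\<dots> = D * (?L q U - q {})"
      by (subst sum_diff1) (simp_all add: round_op_def sum_distrib_left mult_ac right_diff_distrib)
    also have "\<dots> = D * (q U - q {})" by (simp add: L_q)
    also have "\<dots> \<le> D * ((1 - q {}) * q U)"
    proof -
      have "q {} * q U \<le> q {}" using q_le[of U] q0 by simp
      then show ?thesis using D by (intro mult_left_mono) (auto simp: algebra_simps)
    qed
    finally show ?case by (simp add: D_def mult_ac)
  qed (simp add: C)
  have "(\<lambda>k. (?L ^^ k) e U) \<longlonglongrightarrow> 0"
  proof (rule Lim_null_comparison)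
    show "\<forall>\<^sub>F k in sequentially. norm ((?L ^^ k) e U) \<le> C * (1 - q {}) ^ k * q U"
      using bound by simp
    have "(\<lambda>k. (1 - q {}) ^ k) \<longlonglongrightarrow> 0"
      using q0 q_le[of "{}"] by (intro LIMSEQ_realpow_zero) auto
    then show "(\<lambda>k. C * (1 - q {}) ^ k * q U) \<longlonglongrightarrow> 0"
      by (intro tendsto_mult_left_zero tendsto_mult_right_zero)
  qed
  from telescope_sums'[OF this] show ?thesis
    by (simp add: iter b_def[abs_def, symmetric] del: funpow.simps) (simp add: e_def)
qed

section \<open>Translation between \<open>alt_sum\<close> and \<open>q_poly\<close>\<close>

lemma alt_sum_lessThan: "alt_sum vbl m p \<psi> {..<m} = \<psi> 0"
proof -
  have "{J \<in> dep_indep_sets vbl m. J \<inter> {..<m} = {}} = {{}}"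
    using dep_indep_setsD by fastforce
  then show ?thesis by (simp add: alt_sum_def)
qed

lemma q_poly_empty: "q_poly vbl m p {} = alt_sum vbl m p (\<lambda>_. 1) {}"
  by (simp add: q_poly_def alt_sum_def)

text \<open>Double counting of the pairs \<open>i \<in> J\<close>: each \<open>J\<close> is met
  \<open>card J\<close> times, and the exponent \<open>card J - 1\<close> accounts for the overall
  minus sign.\<close>

lemma sum_q_poly_singletons: "(\<Sum>i<m. q_poly vbl m p {i}) = - alt_sum vbl m p real {}"
proof -
  have "(\<Sum>i<m. q_poly vbl m p {i})
      = (\<Sum>i<m. \<Sum>J\<in>dep_indep_sets vbl m. if i \<in> J then (-1) ^ (card J - 1) * prod p J else 0)"
    by (simp add: q_poly_def sum.inter_filter flip: sum.inter_filter)
  also have "\<dots> = (\<Sum>J\<in>dep_indep_sets vbl m. \<Sum>i<m. if i \<in> J then (-1) ^ (card J - 1) * prod p J else 0)"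
    by (rule sum.swap)
  also have "\<dots> = (\<Sum>J\<in>dep_indep_sets vbl m. - ((-1) ^ card J * prod p J * real (card J)))"
  proof (rule sum.cong[OF refl])
    fix J assume J: "J \<in> dep_indep_sets vbl m"
    have "(\<Sum>i<m. if i \<in> J then (-1) ^ (card J - 1) * prod p J else 0)
        = (\<Sum>i\<in>J. (-1) ^ (card J - 1) * prod p J)"
      using dep_indep_setsD[OF J] by (intro sum.mono_neutral_cong_right) auto
    also have "\<dots> = - ((-1) ^ card J * prod p J * real (card J))"
      \<comment> \<open>For \<open>card J = 0\<close> both sides vanish, so the truncated
        subtraction does no harm.\<close>
      using finite_dep_indep_set[OF J] by (cases "card J") auto
    finally show "(\<Sum>i<m. if i \<in> J then (-1) ^ (card J - 1) * prod p J else 0)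
        = - ((-1) ^ card J * prod p J * real (card J))" .
  qed
  finally show ?thesis by (simp add: alt_sum_def sum_negf)
qed

section \<open>One round as a map of the state and a fresh sample\<close>

definition resample_step :: "(nat \<Rightarrow> nat set) \<Rightarrow> nat \<Rightarrow> (nat \<Rightarrow> (nat \<Rightarrow> 'a) set) \<Rightarrow>
    (nat \<Rightarrow> 'a) \<Rightarrow> (nat \<Rightarrow> 'a) \<Rightarrow> nat \<Rightarrow> 'a" where
  "resample_step vbl m A \<sigma> y = override_on \<sigma> y (\<Union>i\<in>occurring m A \<sigma>. vbl i)"

lemma pr_state_Suc:
  "pr_state vbl m A \<omega> (Suc t) = resample_step vbl m A (pr_state vbl m A \<omega> t) (\<omega> (Suc t))"
  by (simp add: resample_step_def override_on_def Let_def)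

text \<open>The first round can be absorbed into the initial assignment, because each later round
  reads only its own entry of the driving sequence.\<close>

lemma pr_state_case_nat:
  "pr_state vbl m A (case_nat s (case_nat y \<omega>)) (Suc k)
    = pr_state vbl m A (case_nat (resample_step vbl m A s y) \<omega>) k"
proof (induction k)
  case (Suc k)
  show ?case by (subst (1 2) pr_state_Suc) (simp only: Suc.IH nat.case)
qed (simp add: pr_state_Suc del: pr_state.simps(2))

section \<open>Extremal events under the product measure\<close>

locale extremal_events = product_prob_space M "{..<n}" for M :: "nat \<Rightarrow> 'a measure" and n +
  fixes m :: nat and vbl :: "nat \<Rightarrow> nat set" and A :: "nat \<Rightarrow> (nat \<Rightarrow> 'a) set"
  assumes events: "\<And>i. i < m \<Longrightarrow> A i \<in> sets (PiM {..<n} M)"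
    and vbl_sub: "\<And>i. i < m \<Longrightarrow> vbl i \<subseteq> {..<n}"
    and determined: "\<And>i x y. i < m \<Longrightarrow> x \<in> space (PiM {..<n} M) \<Longrightarrow> y \<in> space (PiM {..<n} M) \<Longrightarrow>
          (\<forall>k\<in>vbl i. x k = y k) \<Longrightarrow> (x \<in> A i \<longleftrightarrow> y \<in> A i)"
    and extremal: "\<And>i j. i < m \<Longrightarrow> j < m \<Longrightarrow> i \<noteq> j \<Longrightarrow> vbl i \<inter> vbl j \<noteq> {} \<Longrightarrow>
          measure (PiM {..<n} M) (A i \<inter> A j) = 0"
begin

abbreviation \<mu> :: "(nat \<Rightarrow> 'a) measure" where "\<mu> \<equiv> PiM {..<n} M"

definition p :: "nat \<Rightarrow> real" where "p i = measure \<mu> (A i)"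

abbreviation indep :: "nat set set" where "indep \<equiv> dep_indep_sets vbl m"

abbreviation nbhd :: "nat set \<Rightarrow> nat set" where "nbhd \<equiv> closed_nbhd vbl m"

abbreviation vars :: "nat set \<Rightarrow> nat set" where "vars S \<equiv> \<Union>i\<in>S. vbl i"

definition all_occur :: "nat set \<Rightarrow> (nat \<Rightarrow> 'a) set" where
  "all_occur S = {\<sigma> \<in> space \<mu>. \<forall>i\<in>S. \<sigma> \<in> A i}"

definition avoid :: "nat set \<Rightarrow> (nat \<Rightarrow> 'a) set" where
  "avoid U = {\<sigma> \<in> space \<mu>. \<forall>i\<in>{..<m} - U. \<sigma> \<notin> A i}"

lemma sets_all_occur [measurable]: "S \<subseteq> {..<m} \<Longrightarrow> all_occur S \<in> sets \<mu>"
proof -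
  assume S: "S \<subseteq> {..<m}"
  then have eq: "all_occur S = space \<mu> - (\<Union>i\<in>S. space \<mu> - A i)" and "finite S"
    by (auto simp: all_occur_def intro: finite_subset)
  then show ?thesis
    unfolding eq using events S by (intro sets.Diff sets.top sets.finite_UN) auto
qed

lemma sets_avoid [measurable]: "avoid U \<in> sets \<mu>"
proof -
  have "avoid U = space \<mu> - (\<Union>i\<in>{..<m} - U. A i)" by (auto simp: avoid_def)
  then show ?thesis using events by auto
qed

lemma all_occur_dep:
  assumes "S \<subseteq> {..<m}" "x \<in> space \<mu>" "y \<in> space \<mu>" "\<forall>k\<in>vars S. x k = y k"
  shows "x \<in> all_occur S \<longleftrightarrow> y \<in> all_occur S"
  using assms determined[of _ x y] by (fastforce simp: all_occur_def)

text \<open>An event outside \<open>nbhd S\<close> shares no variable with the events in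
  \<open>S\<close>, so resampling \<open>vars S\<close> cannot affect it.\<close>

lemma avoid_dep:
  assumes "S \<subseteq> {..<m}" "x \<in> space \<mu>" "y \<in> space \<mu>" "\<forall>k\<in>{..<n} - vars S. x k = y k"
  shows "x \<in> avoid (nbhd S) \<longleftrightarrow> y \<in> avoid (nbhd S)"
proof -
  have "x \<in> A i \<longleftrightarrow> y \<in> A i" if "i \<in> {..<m} - nbhd S" for i
  proof -
    have "vbl i \<subseteq> {..<n} - vars S"
      using that vbl_sub[of i] by (auto simp: closed_nbhd_iff)
    then have "\<forall>k\<in>vbl i. x k = y k" using assms by blast
    then show ?thesis using that assms determined[of i x y] by auto
  qed
  then show ?thesis using assms by (auto simp: avoid_def)
qed

lemma emeasure_all_occur:
  assumes "S \<in> indep"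
  shows "emeasure \<mu> (all_occur S) = ennreal (prod p S)"
  using finite_dep_indep_set[OF assms] assms
proof (induction S rule: finite_induct)
  case empty
  then show ?case by (simp add: all_occur_def emeasure_space_1)
next
  case (insert i S)
  have i: "i < m" and S: "S \<in> indep" "S \<subseteq> {..<m}"
    using insert.prems dep_indep_setsD[OF insert.prems] by (auto intro: dep_indep_sets_mono)
  have disj: "vbl j \<subseteq> {..<n} - vbl i" if "j \<in> S" for j
    using dep_indep_sets_disjoint[OF insert.prems, of i j] that insert.hyps S vbl_sub[of j] by auto
  have [measurable]: "A i \<in> sets \<mu>" "all_occur S \<in> sets \<mu>" using i S events by auto
  \<comment> \<open>With \<open>h\<close> constantly 1 the resampling identity is plain independence
    of \<open>A i\<close> and \<open>all_occur S\<close>, whose variables are disjoint.\<close>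
  have "(\<integral>\<^sup>+x. indicator (A i) x * indicator (all_occur S) x *
          (\<integral>\<^sup>+y. (\<lambda>_. 1) (override_on x y (vbl i)) \<partial>\<mu>) \<partial>\<mu>)
      = (\<integral>\<^sup>+x. indicator (A i) x \<partial>\<mu>) * (\<integral>\<^sup>+x. indicator (all_occur S) x * 1 \<partial>\<mu>)"
  proof (rule nn_integral_resample)
    fix x y assume xy: "x \<in> space \<mu>" "y \<in> space \<mu>"
    { assume "\<forall>k\<in>vbl i. x k = y k"
      then show "indicator (A i) x = (indicator (A i) y :: ennreal)"
        using determined[OF i xy] by (simp add: indicator_def) }
    { assume "\<forall>k\<in>{..<n} - vbl i. x k = y k"
      then have "\<forall>k\<in>vars S. x k = y k" using disj by blast
      then show "indicator (all_occur S) x = (indicator (all_occur S) y :: ennreal)"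
        using all_occur_dep[OF S(2) xy] by (simp add: indicator_def) }
  qed (use vbl_sub[OF i] in auto)
  then have "emeasure \<mu> (A i \<inter> all_occur S) = emeasure \<mu> (A i) * emeasure \<mu> (all_occur S)"
    by (simp add: emeasure_space_1 flip: indicator_inter_arith)
  moreover have "A i \<inter> all_occur S = all_occur (insert i S)"
    using sets.sets_into_space[OF events[OF i]] by (auto simp: all_occur_def)
  ultimately show ?case
    using insert.IH[OF S(1)] insert.hyps
    by (simp add: p_def emeasure_eq_measure ennreal_mult' prod_nonneg)
qed

lemma measure_all_occur: "S \<in> indep \<Longrightarrow> measure \<mu> (all_occur S) = prod p S"
  using emeasure_all_occur[of S] by (simp add: emeasure_eq_measure p_def prod_nonneg)

lemma AE_occurring_indep: "AE \<sigma> in \<mu>. occurring m A \<sigma> \<in> indep"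
proof -
  have "AE \<sigma> in \<mu>. \<forall>i\<in>{..<m}. \<forall>j\<in>{..<m}. i \<noteq> j \<and> vbl i \<inter> vbl j \<noteq> {} \<longrightarrow> \<not> (\<sigma> \<in> A i \<and> \<sigma> \<in> A j)"
  proof (intro AE_finite_allI)
    fix i j assume ij: "i \<in> {..<m}" "j \<in> {..<m}"
    show "AE \<sigma> in \<mu>. i \<noteq> j \<and> vbl i \<inter> vbl j \<noteq> {} \<longrightarrow> \<not> (\<sigma> \<in> A i \<and> \<sigma> \<in> A j)"
    proof (cases "i \<noteq> j \<and> vbl i \<inter> vbl j \<noteq> {}")
      case True
      then have "A i \<inter> A j \<in> null_sets \<mu>"
        using ij extremal[of i j] events by (auto simp: null_sets_def emeasure_eq_measure)
      from AE_not_in[OF this] show ?thesis by eventually_elim auto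
    qed auto
  qed auto
  then show ?thesis
    by eventually_elim (auto simp: occurring_def intro!: dep_indep_setsI; blast)
qed

lemma measure_all_occur_0:
  assumes "S \<subseteq> {..<m}" "S \<notin> indep"
  shows "measure \<mu> (all_occur S) = 0"
proof -
  have "AE \<sigma> in \<mu>. \<sigma> \<notin> all_occur S"
    using AE_occurring_indep
  proof eventually_elim
    case (elim \<sigma>)
    have "S \<subseteq> occurring m A \<sigma>" if "\<sigma> \<in> all_occur S"
      using that assms by (auto simp: all_occur_def occurring_def)
    then show ?case using elim assms dep_indep_sets_mono by blast
  qed
  then show ?thesis
    using assms by (subst measure_eq_0_null_sets) (auto simp: AE_iff_null_sets)
qed

text \<open>Inclusion-exclusion over the events outside \<open>U\<close>; by extremality the sets
  that are not independent contribute 0. This is where the polynomial \<open>alt_sum\<close>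
  acquires its meaning as a probability, and with it monotonicity in \<open>U\<close> and the bounds
  0 and 1.\<close>

lemma measure_avoid: "measure \<mu> (avoid U) = alt_sum vbl m p (\<lambda>_. 1) U"
proof -
  have ind: "indicator (avoid U) \<sigma> = (\<Sum>S\<in>Pow ({..<m} - U). (-1) ^ card S * indicator (all_occur S) \<sigma> :: real)"
    if \<sigma>: "\<sigma> \<in> space \<mu>" for \<sigma>
  proof -
    have prod_ind: "(\<Prod>i\<in>S. indicator (A i) \<sigma> :: real) = indicator (all_occur S) \<sigma>" if "finite S" for S
      using that \<sigma> by (auto simp: indicator_def all_occur_def prod_zero_iff)
    have "indicator (avoid U) \<sigma> = (\<Prod>i\<in>{..<m} - U. 1 - indicator (A i) \<sigma> :: real)"
      using \<sigma> by (auto simp: indicator_def avoid_def prod_zero_iff)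
    also have "\<dots> = (\<Sum>S\<in>Pow ({..<m} - U). (-1) ^ card S * indicator (all_occur S) \<sigma>)"
      by (subst prod_diff_conv_sum, simp, intro sum.cong refl, subst prod_ind)
        (auto intro: finite_subset[of _ "{..<m}"])
    finally show ?thesis .
  qed
  have "measure \<mu> (avoid U) = (\<integral>\<sigma>. indicator (avoid U) \<sigma> \<partial>\<mu>)" by simp
  also have "\<dots> = (\<integral>\<sigma>. (\<Sum>S\<in>Pow ({..<m} - U). (-1) ^ card S * indicator (all_occur S) \<sigma> :: real) \<partial>\<mu>)"
    by (intro Bochner_Integration.integral_cong refl ind)
  also have "\<dots> = (\<Sum>S\<in>Pow ({..<m} - U). (-1) ^ card S * measure \<mu> (all_occur S))"
  proof -
    have sets: "all_occur S \<in> sets \<mu>" if "S \<in> Pow ({..<m} - U)" for S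
      using that by (intro sets_all_occur) auto
    have "integrable \<mu> (\<lambda>\<sigma>. (-1) ^ card S * indicator (all_occur S) \<sigma> :: real)"
      if "S \<in> Pow ({..<m} - U)" for S
      using sets[OF that] by (intro integrable_mult_right integrable_real_indicator) (auto simp: less_top[symmetric])
    then show ?thesis
      using sets
      by (subst Bochner_Integration.integral_sum)
         (auto intro!: sum.cong simp: Int_absorb2 sets.sets_into_space)
  qed
  also have "\<dots> = alt_sum vbl m p (\<lambda>_. 1) U"
    unfolding alt_sum_def
  proof (intro sum.mono_neutral_cong_right ballI)
    show "{J \<in> indep. J \<inter> U = {}} \<subseteq> Pow ({..<m} - U)"
      by (auto dest: dep_indep_setsD)
  next
    fix S assume "S \<in> Pow ({..<m} - U) - {J \<in> indep. J \<inter> U = {}}"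
    then have "S \<subseteq> {..<m}" "S \<notin> indep" by auto
    then show "(-1) ^ card S * measure \<mu> (all_occur S) = 0"
      by (simp add: measure_all_occur_0)
  qed (auto simp: measure_all_occur)
  finally show ?thesis .
qed

lemma occurring_measurable [measurable]: "occurring m A \<in> measurable \<mu> (count_space UNIV)"
proof -
  \<comment> \<open>Only finitely many values are possible, so measurability reduces to these
    fibres.\<close>
  have "occurring m A -` {S} \<inter> space \<mu> = all_occur S \<inter> avoid S" if "S \<subseteq> {..<m}" for S
    using that by (auto simp: occurring_def all_occur_def avoid_def)
  then have "occurring m A \<in> measurable \<mu> (count_space (Pow {..<m}))"
    by (subst measurable_count_space_eq2) (auto simp: occurring_def)
  from measurable_compose[OF this, of "\<lambda>S. S"] show ?thesis by simp
qed

lemma measurable_resample_step [measurable]: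
  "(\<lambda>(\<sigma>, y). resample_step vbl m A \<sigma> y) \<in> \<mu> \<Otimes>\<^sub>M \<mu> \<rightarrow>\<^sub>M \<mu>"
proof (rule measurable_PiM_single')
  fix k assume k: "k \<in> {..<n}"
  have [measurable]: "Measurable.pred \<mu> (\<lambda>\<sigma>. k \<in> vars (occurring m A \<sigma>))"
    by (rule measurable_compose[OF occurring_measurable]) simp
  have "(\<lambda>\<omega>. if k \<in> vars (occurring m A (fst \<omega>)) then snd \<omega> k else fst \<omega> k) \<in> \<mu> \<Otimes>\<^sub>M \<mu> \<rightarrow>\<^sub>M M k"
    using k by measurable
  then show "(\<lambda>\<omega>. (case \<omega> of (\<sigma>, y) \<Rightarrow> resample_step vbl m A \<sigma> y) k) \<in> \<mu> \<Otimes>\<^sub>M \<mu> \<rightarrow>\<^sub>M M k"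
    by (simp add: resample_step_def override_on_def split_beta')
next
  have "resample_step vbl m A \<sigma> y \<in> space \<mu>" if "\<sigma> \<in> space \<mu>" "y \<in> space \<mu>" for \<sigma> y
    using that unfolding space_PiM resample_step_def override_on_def
    by (auto simp: PiE_iff extensional_def)
  then show "(\<lambda>(\<sigma>, y). resample_step vbl m A \<sigma> y) \<in> space (\<mu> \<Otimes>\<^sub>M \<mu>) \<rightarrow> (\<Pi>\<^sub>E k\<in>{..<n}. space (M k))"
    by (auto simp: space_pair_measure simp flip: space_PiM)
qed

text \<open>Up to a null set, extremality makes \<open>{\<sigma>. occurring m A \<sigma> = S}\<close> the intersection of
  \<open>all_occur S\<close>, which depends on the resampled variables only, and \<open>avoid (nbhd S)\<close>, which
  depends on the others only.\<close>
lemma nn_integral_resample_step: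
  fixes \<phi> :: "nat set \<Rightarrow> ennreal"
  assumes h [measurable]: "h \<in> borel_measurable \<mu>"
  shows "(\<integral>\<^sup>+\<sigma>. indicator (avoid U) \<sigma> * \<phi> (occurring m A \<sigma>) *
            (\<integral>\<^sup>+y. h (resample_step vbl m A \<sigma> y) \<partial>\<mu>) \<partial>\<mu>)
       = (\<Sum>S\<in>{S \<in> indep. S \<subseteq> U}. \<phi> S * ennreal (prod p S) *
            (\<integral>\<^sup>+\<sigma>. indicator (avoid (nbhd S)) \<sigma> * h \<sigma> \<partial>\<mu>))"
proof -
  let ?R = "\<lambda>S \<sigma>. \<integral>\<^sup>+y. h (override_on \<sigma> y (vars S)) \<partial>\<mu>"
  have meas [measurable]: "all_occur S \<in> sets \<mu>" if "S \<in> indep" for S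
    using dep_indep_setsD[OF that] by simp
  have vars_sub: "vars S \<subseteq> {..<n}" if "S \<in> indep" for S
    using dep_indep_setsD[OF that] vbl_sub by blast
  have R_meas [measurable]: "?R S \<in> borel_measurable \<mu>" if "S \<in> indep" for S
  proof -
    have "(\<lambda>(x, y). override_on x y (vars S)) \<in> \<mu> \<Otimes>\<^sub>M \<mu> \<rightarrow>\<^sub>M \<mu>"
      using vars_sub[OF that] by (rule measurable_override_on)
    then show ?thesis by measurable
  qed
  have "(\<integral>\<^sup>+\<sigma>. indicator (avoid U) \<sigma> * \<phi> (occurring m A \<sigma>) *
            (\<integral>\<^sup>+y. h (resample_step vbl m A \<sigma> y) \<partial>\<mu>) \<partial>\<mu>)
      = (\<integral>\<^sup>+\<sigma>. (\<Sum>S\<in>{S \<in> indep. S \<subseteq> U}. \<phi> S *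
            (indicator (all_occur S) \<sigma> * indicator (avoid (nbhd S)) \<sigma> * ?R S \<sigma>)) \<partial>\<mu>)"
  proof (rule nn_integral_cong_AE)
    show "AE \<sigma> in \<mu>. indicator (avoid U) \<sigma> * \<phi> (occurring m A \<sigma>) *
            (\<integral>\<^sup>+y. h (resample_step vbl m A \<sigma> y) \<partial>\<mu>)
        = (\<Sum>S\<in>{S \<in> indep. S \<subseteq> U}. \<phi> S *
            (indicator (all_occur S) \<sigma> * indicator (avoid (nbhd S)) \<sigma> * ?R S \<sigma>))"
      using AE_occurring_indep AE_space
    proof eventually_elim
      case (elim \<sigma>)
      let ?O = "occurring m A \<sigma>"
      \<comment> \<open>An event that occurs must lie in \<open>nbhd S\<close>, hence equals or
        meets a member of \<open>S\<close>, which occurs too. Independence of the occurring set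
        leaves only equality.\<close>
      have exact: "\<sigma> \<in> all_occur S \<and> \<sigma> \<in> avoid (nbhd S) \<longleftrightarrow> S = ?O" if S: "S \<in> indep" for S
      proof
        assume *: "\<sigma> \<in> all_occur S \<and> \<sigma> \<in> avoid (nbhd S)"
        then have sub: "S \<subseteq> ?O"
          using dep_indep_setsD[OF S] by (auto simp: all_occur_def occurring_def)
        have "i \<in> S" if i: "i \<in> ?O" for i
        proof -
          have "i \<in> nbhd S" using * i by (auto simp: avoid_def occurring_def)
          then obtain j where "j \<in> S" "i = j \<or> vbl i \<inter> vbl j \<noteq> {}"
            by (auto simp: closed_nbhd_iff)
          then show ?thesis
            using dep_indep_sets_disjoint[OF elim(1) i, of j] sub by auto
        qed
        with sub show "S = ?O" by auto
      next
        assume "S = ?O"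
        then show "\<sigma> \<in> all_occur S \<and> \<sigma> \<in> avoid (nbhd S)"
          using elim(2) by (auto simp: all_occur_def avoid_def occurring_def closed_nbhd_iff)
      qed
      have "\<sigma> \<in> avoid U \<longleftrightarrow> ?O \<subseteq> U"
        using elim(2) by (auto simp: avoid_def occurring_def)
      then have "indicator (avoid U) \<sigma> * \<phi> ?O * (\<integral>\<^sup>+y. h (resample_step vbl m A \<sigma> y) \<partial>\<mu>)
          = (if ?O \<in> {S \<in> indep. S \<subseteq> U} then \<phi> ?O * ?R ?O \<sigma> else 0)"
        using elim(1) by (simp add: resample_step_def)
      also have "\<dots> = (\<Sum>S\<in>{S \<in> indep. S \<subseteq> U}. if ?O = S then \<phi> S * ?R S \<sigma> else 0)"
        by (subst sum.delta') auto
      also have "\<dots> = (\<Sum>S\<in>{S \<in> indep. S \<subseteq> U}. \<phi> S *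
            (indicator (all_occur S) \<sigma> * indicator (avoid (nbhd S)) \<sigma> * ?R S \<sigma>))"
        using exact by (intro sum.cong refl) (auto simp: indicator_def)
      finally show ?case .
    qed
  qed
  also have "\<dots> = (\<Sum>S\<in>{S \<in> indep. S \<subseteq> U}. \<phi> S *
      (\<integral>\<^sup>+\<sigma>. indicator (all_occur S) \<sigma> * indicator (avoid (nbhd S)) \<sigma> * ?R S \<sigma> \<partial>\<mu>))"
  proof -
    have [measurable]: "(\<lambda>\<sigma>. indicator (all_occur S) \<sigma> * indicator (avoid (nbhd S)) \<sigma> * ?R S \<sigma>)
        \<in> borel_measurable \<mu>" if "S \<in> {S \<in> indep. S \<subseteq> U}" for S
    proof -
      have "S \<in> indep" using that by simp
      note [measurable] = meas[OF this] R_meas[OF this]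
      show ?thesis by measurable
    qed
    show ?thesis
    proof (subst nn_integral_sum)
      show "(\<Sum>S\<in>{S \<in> indep. S \<subseteq> U}. \<integral>\<^sup>+\<sigma>. \<phi> S *
            (indicator (all_occur S) \<sigma> * indicator (avoid (nbhd S)) \<sigma> * ?R S \<sigma>) \<partial>\<mu>)
        = (\<Sum>S\<in>{S \<in> indep. S \<subseteq> U}. \<phi> S *
            (\<integral>\<^sup>+\<sigma>. indicator (all_occur S) \<sigma> * indicator (avoid (nbhd S)) \<sigma> * ?R S \<sigma> \<partial>\<mu>))"
        by (intro sum.cong refl nn_integral_cmult) measurable
    qed measurable
  qed
  also have "\<dots> = (\<Sum>S\<in>{S \<in> indep. S \<subseteq> U}. \<phi> S * ennreal (prod p S) *
            (\<integral>\<^sup>+\<sigma>. indicator (avoid (nbhd S)) \<sigma> * h \<sigma> \<partial>\<mu>))"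
  proof (intro sum.cong refl)
    fix S assume "S \<in> {S \<in> indep. S \<subseteq> U}"
    then have S: "S \<in> indep" and S': "S \<subseteq> {..<m}" by (auto dest: dep_indep_setsD)
    have "(\<integral>\<^sup>+\<sigma>. indicator (all_occur S) \<sigma> * indicator (avoid (nbhd S)) \<sigma> * ?R S \<sigma> \<partial>\<mu>)
        = (\<integral>\<^sup>+\<sigma>. indicator (all_occur S) \<sigma> \<partial>\<mu>) * (\<integral>\<^sup>+\<sigma>. indicator (avoid (nbhd S)) \<sigma> * h \<sigma> \<partial>\<mu>)"
    proof (rule nn_integral_resample)
      fix x y assume xy: "x \<in> space \<mu>" "y \<in> space \<mu>"
      { assume "\<forall>k\<in>vars S. x k = y k"
        from all_occur_dep[OF S' xy this]
        show "indicator (all_occur S) x = (indicator (all_occur S) y :: ennreal)"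
          by (simp add: indicator_def) }
      { assume "\<forall>k\<in>{..<n} - vars S. x k = y k"
        from avoid_dep[OF S' xy this]
        show "indicator (avoid (nbhd S)) x = (indicator (avoid (nbhd S)) y :: ennreal)"
          by (simp add: indicator_def) }
    qed (use vars_sub[OF S] meas[OF S] in auto)
    then show "\<phi> S * (\<integral>\<^sup>+\<sigma>. indicator (all_occur S) \<sigma> * indicator (avoid (nbhd S)) \<sigma> * ?R S \<sigma> \<partial>\<mu>)
        = \<phi> S * ennreal (prod p S) * (\<integral>\<^sup>+\<sigma>. indicator (avoid (nbhd S)) \<sigma> * h \<sigma> \<partial>\<mu>)"
      using S by (simp add: emeasure_all_occur mult.assoc)
  qed
  finally show ?thesis .
qed

end

section \<open>Peeling rounds off the driving sequence and the expected total\<close>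

lemma (in sequence_space) nn_integral_case_nat:
  assumes F [measurable]: "F \<in> borel_measurable S"
  shows "(\<integral>\<^sup>+\<omega>. F \<omega> \<partial>S) = (\<integral>\<^sup>+s. \<integral>\<^sup>+\<omega>. F (case_nat s \<omega>) \<partial>S \<partial>M)"
proof -
  have "(\<integral>\<^sup>+\<omega>. F \<omega> \<partial>S) = (\<integral>\<^sup>+\<omega>. F \<omega> \<partial>distr (M \<Otimes>\<^sub>M S) S (\<lambda>(s, \<omega>). case_nat s \<omega>))"
    \<comment> \<open>Prepending an independent sample to an i.i.d. sequence reproduces its
      law.\<close>
    by (simp add: PiM_iter)
  also have "\<dots> = (\<integral>\<^sup>+z. F (case_nat (fst z) (snd z)) \<partial>(M \<Otimes>\<^sub>M S))"
    by (subst nn_integral_distr) (auto simp: split_beta')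
  also have "\<dots> = (\<integral>\<^sup>+s. \<integral>\<^sup>+\<omega>. F (case_nat s \<omega>) \<partial>S \<partial>M)"
    by (subst P.nn_integral_fst[symmetric]) auto
  finally show ?thesis .
qed

context extremal_events
begin

interpretation seq: sequence_space \<mu>
  by (unfold_locales)

abbreviation \<Omega> :: "(nat \<Rightarrow> nat \<Rightarrow> 'a) measure" where "\<Omega> \<equiv> PiM UNIV (\<lambda>_. \<mu>)"

lemma measurable_pr_state [measurable]: "(\<lambda>\<omega>. pr_state vbl m A \<omega> k) \<in> \<Omega> \<rightarrow>\<^sub>M \<mu>"
proof (induction k)
  case (Suc k)
  note [measurable] = Suc.IH
  have "(\<lambda>\<omega>. (\<lambda>(\<sigma>, y). resample_step vbl m A \<sigma> y) (pr_state vbl m A \<omega> k, \<omega> (Suc k))) \<in> \<Omega> \<rightarrow>\<^sub>M \<mu>"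
    by measurable
  then show ?case unfolding pr_state_Suc by simp
qed simp

lemma measurable_card_occurring:
  "(\<lambda>\<omega>. of_nat (card (occurring m A (pr_state vbl m A \<omega> k))) :: ennreal) \<in> borel_measurable \<Omega>"
  by (rule measurable_compose[OF measurable_compose[OF measurable_pr_state occurring_measurable]]) simp

text \<open>The conditional expectation given the initial assignment \<open>s\<close>. Keeping
  \<open>s\<close> apart from the later samples is what allows an induction on the number of
  rounds.\<close>

definition expected_occurring :: "nat \<Rightarrow> (nat \<Rightarrow> 'a) \<Rightarrow> ennreal" where
  "expected_occurring k s = (\<integral>\<^sup>+\<omega>. of_nat (card (occurring m A (pr_state vbl m A (case_nat s \<omega>) k))) \<partial>\<Omega>)"

lemma measurable_expected_occurring [measurable]: "expected_occurring k \<in> borel_measurable \<mu>"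
proof -
  have "(\<lambda>z. case_nat (fst z) (snd z)) \<in> \<mu> \<Otimes>\<^sub>M \<Omega> \<rightarrow>\<^sub>M \<Omega>" by measurable
  from measurable_compose[OF this measurable_card_occurring[of k]] show ?thesis
    unfolding expected_occurring_def[abs_def]
    by (intro seq.P.borel_measurable_nn_integral) (simp add: split_beta')
qed

lemma nn_integral_occurring:
  "(\<integral>\<^sup>+\<omega>. of_nat (card (occurring m A (pr_state vbl m A \<omega> k))) \<partial>\<Omega>)
     = (\<integral>\<^sup>+s. expected_occurring k s \<partial>\<mu>)"
  unfolding expected_occurring_def by (rule seq.nn_integral_case_nat[OF measurable_card_occurring])

lemma expected_occurring_0: "expected_occurring 0 s = of_nat (card (occurring m A s))"
  by (simp add: expected_occurring_def seq.P.emeasure_space_1)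

text \<open>The Markov property: the next sample \<open>y\<close> is split off the sequence and
  spent on the first round, after which the remaining samples drive a run from the new
  state.\<close>

lemma expected_occurring_Suc:
  assumes [measurable]: "s \<in> space \<mu>"
  shows "expected_occurring (Suc k) s = (\<integral>\<^sup>+y. expected_occurring k (resample_step vbl m A s y) \<partial>\<mu>)"
proof -
  have "expected_occurring (Suc k) s = (\<integral>\<^sup>+y. \<integral>\<^sup>+\<omega>.
      of_nat (card (occurring m A (pr_state vbl m A (case_nat s (case_nat y \<omega>)) (Suc k)))) \<partial>\<Omega> \<partial>\<mu>)"
    unfolding expected_occurring_def
  proof (rule seq.nn_integral_case_nat)
    have "(\<lambda>\<omega>. case_nat s \<omega>) \<in> \<Omega> \<rightarrow>\<^sub>M \<Omega>" by measurable
    from measurable_compose[OF this measurable_card_occurring[of "Suc k"]]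
    show "(\<lambda>\<omega>. of_nat (card (occurring m A (pr_state vbl m A (case_nat s \<omega>) (Suc k)))) :: ennreal)
        \<in> borel_measurable \<Omega>" .
  qed
  then show ?thesis
    by (simp only: pr_state_case_nat expected_occurring_def)
qed

lemma p_nonneg: "0 \<le> p i"
  by (simp add: p_def)

lemma alt_sum_nonneg: "0 \<le> alt_sum vbl m p (\<lambda>_. 1) U"
  by (simp flip: measure_avoid)

lemma iterate_nonneg:
  "0 \<le> (round_op vbl m p ^^ k) (\<lambda>U. \<Sum>S\<in>{S \<in> indep. S \<subseteq> U}.
        real (card S) * prod p S * alt_sum vbl m p (\<lambda>_. 1) (nbhd S)) U"
  by (intro round_op_iterate_nonneg sum_nonneg mult_nonneg_nonneg prod_nonneg p_nonneg
      alt_sum_nonneg of_nat_0_le_iff)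

text \<open>Each induction step removes the first round by \<open>nn_integral_resample_step\<close>,
  which is one application of \<open>round_op\<close>. The set \<open>U\<close> has to vary, since
  the run restarts with \<open>nbhd S\<close> in its place.\<close>

lemma nn_integral_avoid_expected_occurring:
  "(\<integral>\<^sup>+\<sigma>. indicator (avoid U) \<sigma> * expected_occurring k \<sigma> \<partial>\<mu>)
    = ennreal ((round_op vbl m p ^^ k) (\<lambda>U. \<Sum>S\<in>{S \<in> indep. S \<subseteq> U}.
        real (card S) * prod p S * alt_sum vbl m p (\<lambda>_. 1) (nbhd S)) U)"
  (is "_ = ennreal (?H k U)")
proof (induction k arbitrary: U)
  case 0
  have q: "(\<integral>\<^sup>+\<sigma>. indicator (avoid V) \<sigma> * 1 \<partial>\<mu>) = ennreal (alt_sum vbl m p (\<lambda>_. 1) V)" for V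
    by (simp add: P.emeasure_eq_measure flip: measure_avoid)
  \<comment> \<open>A dummy resampling with \<open>h = 1\<close> brings the count into the form of
    the one-round identity, with \<open>\<phi>\<close> the cardinality.\<close>
  have "(\<integral>\<^sup>+\<sigma>. indicator (avoid U) \<sigma> * expected_occurring 0 \<sigma> \<partial>\<mu>)
      = (\<integral>\<^sup>+\<sigma>. indicator (avoid U) \<sigma> * of_nat (card (occurring m A \<sigma>)) *
          (\<integral>\<^sup>+y. (\<lambda>_. 1) (resample_step vbl m A \<sigma> y) \<partial>\<mu>) \<partial>\<mu>)"
    by (simp add: expected_occurring_0 P.emeasure_space_1)
  also have "\<dots> = (\<Sum>S\<in>{S \<in> indep. S \<subseteq> U}. of_nat (card S) * ennreal (prod p S) *
          (\<integral>\<^sup>+\<sigma>. indicator (avoid (nbhd S)) \<sigma> * 1 \<partial>\<mu>))"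
    by (rule nn_integral_resample_step) simp
  also have "\<dots> = (\<Sum>S\<in>{S \<in> indep. S \<subseteq> U}.
      ennreal (real (card S) * prod p S * alt_sum vbl m p (\<lambda>_. 1) (nbhd S)))"
    unfolding q by (simp add: p_nonneg prod_nonneg ennreal_mult' alt_sum_nonneg ennreal_of_nat_eq_real_of_nat)
  also have "\<dots> = ennreal (?H 0 U)"
    by (subst sum_ennreal) (simp_all add: p_nonneg prod_nonneg alt_sum_nonneg)
  finally show ?case .
next
  case (Suc k)
  have "(\<integral>\<^sup>+\<sigma>. indicator (avoid U) \<sigma> * expected_occurring (Suc k) \<sigma> \<partial>\<mu>)
      = (\<integral>\<^sup>+\<sigma>. indicator (avoid U) \<sigma> * 1 *
          (\<integral>\<^sup>+y. expected_occurring k (resample_step vbl m A \<sigma> y) \<partial>\<mu>) \<partial>\<mu>)"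
    by (intro nn_integral_cong) (simp add: expected_occurring_Suc)
  also have "\<dots> = (\<Sum>S\<in>{S \<in> indep. S \<subseteq> U}. 1 * ennreal (prod p S) *
          (\<integral>\<^sup>+\<sigma>. indicator (avoid (nbhd S)) \<sigma> * expected_occurring k \<sigma> \<partial>\<mu>))"
    by (rule nn_integral_resample_step) measurable
  also have "\<dots> = (\<Sum>S\<in>{S \<in> indep. S \<subseteq> U}. ennreal (prod p S * ?H k (nbhd S)))"
    unfolding Suc.IH by (intro sum.cong refl) (simp add: ennreal_mult' prod_nonneg p_nonneg)
  also have "\<dots> = ennreal (\<Sum>S\<in>{S \<in> indep. S \<subseteq> U}. prod p S * ?H k (nbhd S))"
    by (intro sum_ennreal mult_nonneg_nonneg prod_nonneg iterate_nonneg p_nonneg)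
  also have "\<dots> = ennreal (?H (Suc k) U)"
    by (simp only: funpow.simps o_apply round_op_def[of _ _ _ "?H k"])
  finally show ?case .
qed

text \<open>The run starts at \<open>U = {..<m}\<close>, where no event is excluded. There
  \<open>q\<close> is 1 and \<open>r\<close> is 0, so the limit of the series is
  \<open>- r {} / q {}\<close>, which \<open>sum_q_poly_singletons\<close> identifies.\<close>

lemma expected_resample_count:
  assumes q_pos: "q_poly vbl m p {} > 0"
  shows "(\<integral>\<^sup>+\<omega>. resample_count vbl m A \<omega> \<partial>\<Omega>)
           = ennreal (\<Sum>i<m. q_poly vbl m p {i} / q_poly vbl m p {})"
proof -
  define H where "H k = (round_op vbl m p ^^ k) (\<lambda>U. \<Sum>S\<in>{S \<in> indep. S \<subseteq> U}.
        real (card S) * prod p S * alt_sum vbl m p (\<lambda>_. 1) (nbhd S)) {..<m}" for k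
  have avoid_all: "avoid {..<m} = space \<mu>" by (auto simp: avoid_def)
  have H: "(\<integral>\<^sup>+s. expected_occurring k s \<partial>\<mu>) = ennreal (H k)" for k
  proof -
    have "(\<integral>\<^sup>+s. expected_occurring k s \<partial>\<mu>) = (\<integral>\<^sup>+s. indicator (avoid {..<m}) s * expected_occurring k s \<partial>\<mu>)"
      unfolding avoid_all by (intro nn_integral_cong) simp
    then show ?thesis by (simp add: nn_integral_avoid_expected_occurring H_def)
  qed
  have "H sums (alt_sum vbl m p real {..<m} - alt_sum vbl m p (\<lambda>_. 1) {..<m} *
      alt_sum vbl m p real {} / alt_sum vbl m p (\<lambda>_. 1) {})"
    unfolding H_def
  proof (rule sums_round_op_iterates)
    show "alt_sum vbl m p (\<lambda>_. 1) {} \<le> alt_sum vbl m p (\<lambda>_. 1) U" for U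
      unfolding measure_avoid[symmetric]
      by (intro P.finite_measure_mono sets_avoid) (auto simp: avoid_def)
    show "alt_sum vbl m p (\<lambda>_. 1) U \<le> 1" for U
      unfolding measure_avoid[symmetric] by simp
  qed (use q_pos p_nonneg in \<open>auto simp: q_poly_empty\<close>)
  also have "alt_sum vbl m p real {..<m} - alt_sum vbl m p (\<lambda>_. 1) {..<m} *
      alt_sum vbl m p real {} / alt_sum vbl m p (\<lambda>_. 1) {}
      = (\<Sum>i<m. q_poly vbl m p {i} / q_poly vbl m p {})"
    by (simp add: alt_sum_lessThan q_poly_empty sum_q_poly_singletons flip: sum_divide_distrib)
  finally have sums: "H sums (\<Sum>i<m. q_poly vbl m p {i} / q_poly vbl m p {})" .
  have "(\<integral>\<^sup>+\<omega>. resample_count vbl m A \<omega> \<partial>\<Omega>)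
      = (\<Sum>k. \<integral>\<^sup>+\<omega>. of_nat (card (occurring m A (pr_state vbl m A \<omega> k))) \<partial>\<Omega>)"
    unfolding resample_count_def by (rule nn_integral_suminf[OF measurable_card_occurring])
  also have "\<dots> = (\<Sum>k. ennreal (H k))"
    by (simp add: nn_integral_occurring H)
  also have "\<dots> = ennreal (\<Sum>i<m. q_poly vbl m p {i} / q_poly vbl m p {})"
    by (intro suminf_ennreal_eq sums) (simp add: H_def iterate_nonneg)
  finally show ?thesis .
qed

end

theorem theorem13:
  fixes M :: "nat \<Rightarrow> 'a measure" and n m :: nat
    and vbl :: "nat \<Rightarrow> nat set" and A :: "nat \<Rightarrow> (nat \<Rightarrow> 'a) set"
  defines "\<mu> \<equiv> PiM {..<n} M"
  defines "p \<equiv> (\<lambda>i. measure \<mu> (A i))"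
  assumes prob: "\<And>k. k < n \<Longrightarrow> prob_space (M k)"
    and events: "\<And>i. i < m \<Longrightarrow> A i \<in> sets \<mu>"
    and vbl_sub: "\<And>i. i < m \<Longrightarrow> vbl i \<subseteq> {..<n}"
    and determined: "\<And>i x y. i < m \<Longrightarrow> x \<in> space \<mu> \<Longrightarrow> y \<in> space \<mu> \<Longrightarrow>
                       (\<forall>k\<in>vbl i. x k = y k) \<Longrightarrow> (x \<in> A i \<longleftrightarrow> y \<in> A i)"
    and extremal: "\<And>i j. i < m \<Longrightarrow> j < m \<Longrightarrow> i \<noteq> j \<Longrightarrow> vbl i \<inter> vbl j \<noteq> {} \<Longrightarrow>
                       measure \<mu> (A i \<inter> A j) = 0"
    and q_pos: "q_poly vbl m p {} > 0"
  shows "(\<integral>\<^sup>+\<omega>. resample_count vbl m A \<omega> \<partial>(PiM (UNIV :: nat set) (\<lambda>_. \<mu>)))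
           = ennreal (\<Sum>i<m. q_poly vbl m p {i} / q_poly vbl m p {})"
proof -
  \<comment> \<open>\<open>M k\<close> is arbitrary for \<open>k \<ge> n\<close>, but the product locales want a probability space at every index.\<close>
  define M' where "M' k = (if k < n then M k else return (count_space UNIV) undefined)" for k
  have \<mu>: "\<mu> = PiM {..<n} M'"
    unfolding \<mu>_def by (rule PiM_cong) (simp_all add: M'_def)
  have M': "prob_space (M' k)" for k
    using prob by (simp add: M'_def prob_space_return)
  interpret E: extremal_events M' n m vbl A
    by (intro extremal_events.intro product_prob_spaceI extremal_events_axioms.intro M')
      (fact events[unfolded \<mu>] vbl_sub determined[unfolded \<mu>] extremal[unfolded \<mu>])+
  have "p = E.p"
    by (simp add: p_def E.p_def \<mu> fun_eq_iff)
  then show ?thesis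
    using E.expected_resample_count q_pos by (simp add: \<mu>)
qed

end
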